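(* Let $g:(0,\infty)\to[0,\infty)$ be a decreasing function and let $\alpha\in(0,1)$. Let $\mathcal{F}(g,\alpha)$ be the family of all decreasing functions $f:(0,\infty)\to[0,\infty)$ satisfying \[ f(r+s)\le g(r)+\alpha f(s)\quad\text{for all } r,s>0. \] If \[ \int_0^1\log^+ g(t)\,dt=\infty, \] then \[ \sup_{f\in\mathcal{F}(g,\alpha)}f(x)=\infty\quad\text{for all } x\in(0,\infty). \]
   Context: "Decreasing" means non-increasing (not necessarily strictly). $\log^+(x):=\log\max\{x,1\}$. *)

theory Defs
  imports "HOL-Analysis.Analysis"
begin

definition ln_plus :: "real \<Rightarrow> real" where
  "ln_plus x = ln (max x 1)"

(* Functions (0,\<infinity>) \<rightarrow> [0,\<infinity>) are represented by total functions on the reals that are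
   constrained only on {0<..}; their values elsewhere are arbitrary and never used. *)
definition decreasing_nonneg :: "(real \<Rightarrow> real) \<Rightarrow> bool" where
  "decreasing_nonneg f \<longleftrightarrow> f \<in> {0<..} \<rightarrow> {0..} \<and> antimono_on {0<..} f"

definition family :: "(real \<Rightarrow> real) \<Rightarrow> real \<Rightarrow> (real \<Rightarrow> real) set" where
  "family g \<alpha> = {f. decreasing_nonneg f \<and> (\<forall>r>0. \<forall>s>0. f (r + s) \<le> g r + \<alpha> * f s)}"

end

theory Submission
  imports Defs
begin

text \<open>
  The only way for \<open>f\<close> to violate \<open>f (r + s) \<le> g r + \<alpha> * f s\<close> is that \<open>f\<close> grows by less than the
  factor \<open>1 / \<alpha>\<close> when its argument drops from \<open>r + s\<close> to \<open>s\<close>, for some \<open>r\<close> at which \<open>g r\<close> is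
  small compared with \<open>f (r + s)\<close>.  This suggests a step function: take \<open>0\<close> to the
  right of \<open>x\<close> and levels from \<open>M \<ge> 1\<close> upwards when moving from \<open>x\<close> to the left, and stay on the level \<open>M / \<alpha> ^ k\<close> exactly
  as long as \<open>g \<ge> M / \<alpha> ^ k\<close> allows, that is, for the length \<open>d k\<close> of the set of those
  \<open>t \<in> (0,1)\<close> with \<open>g t \<ge> M / \<alpha> ^ k\<close>.  Two arguments on the same level then differ by some
  \<open>r < d k\<close>, for which \<open>g r\<close> alone bounds the left-hand side; on two different levels the factor
  \<open>1 / \<alpha>\<close> has been gained, and \<open>\<alpha> * f s\<close> alone bounds it
  (\<open>step_function_in_family\<close>).

  The steps reach every point of \<open>(0,x]\<close> as soon as \<open>(\<Sum>k. d k)\<close> diverges.  This is where the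
  integral enters: by the layer-cake formula on a logarithmic scale, the integral of
  \<open>ln_plus (g t)\<close> over \<open>(0,1)\<close> is at most \<open>ln M + ln (1 / \<alpha>) * (\<Sum>k. d k)\<close>
  (\<open>nn_integral_ln_plus_le\<close>).  Since \<open>f x \<ge> M\<close> and \<open>M\<close> can be taken
  arbitrarily large, the supremum at \<open>x\<close> is infinite.
\<close>

definition superlevel_length :: "(real \<Rightarrow> real) \<Rightarrow> real \<Rightarrow> real" where
  "superlevel_length g c = measure lborel {t\<in>{0<..<1}. c \<le> g t}"

lemma superlevel_sets_borel:
  fixes g :: "real \<Rightarrow> real"
  assumes "antimono_on {0<..} g"
  shows "{t\<in>{0<..<1}. c \<le> g t} \<in> sets borel"
proof (rule real_interval_borel_measurable)
  show "is_interval {t\<in>{0<..<1}. c \<le> g t}"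
    unfolding is_interval_1
  proof (intro ballI allI impI)
    fix a b t
    assume ab: "a \<in> {t\<in>{0<..<1}. c \<le> g t}" "b \<in> {t\<in>{0<..<1}. c \<le> g t}"
      and t: "a \<le> t \<and> t \<le> b"
    then have "g b \<le> g t"
      using assms by (auto simp: monotone_on_def)
    then show "t \<in> {t\<in>{0<..<1}. c \<le> g t}"
      using ab t by auto
  qed
qed

lemma emeasure_superlevel:
  "emeasure lborel {t\<in>{0<..<1}. c \<le> g t} = ennreal (superlevel_length g c)"
  unfolding superlevel_length_def
proof (rule emeasure_eq_ennreal_measure)
  have "emeasure lborel {t\<in>{0<..<1::real}. c \<le> g t} \<le> emeasure lborel {0<..<1::real}"
    by (intro emeasure_mono) auto
  then show "emeasure lborel {t\<in>{0<..<1}. c \<le> g t} \<noteq> top"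
    by (auto simp: top_unique)
qed

lemma superlevel_length_nonneg: "0 \<le> superlevel_length g c"
  by (simp add: superlevel_length_def)

text \<open>For decreasing \<open>g\<close> the superlevel set is an initial interval of \<open>(0,1)\<close>, so a point to the
  left of its length belongs to it.\<close>

lemma level_le_of_less_superlevel_length:
  assumes "antimono_on {0<..} g" "0 < r" "r < superlevel_length g c"
  shows "c \<le> g r"
proof (rule ccontr)
  assume "\<not> c \<le> g r"
  have "{t\<in>{0<..<1}. c \<le> g t} \<subseteq> {0<..<r}"
  proof
    fix t assume t: "t \<in> {t\<in>{0<..<1}. c \<le> g t}"
    have "g t \<le> g r" if "r \<le> t"
      using assms(1,2) that by (auto simp: monotone_on_def)
    then show "t \<in> {0<..<r}"
      using t \<open>\<not> c \<le> g r\<close> by force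
  qed
  then have "emeasure lborel {t\<in>{0<..<1}. c \<le> g t} \<le> emeasure lborel {0<..<r}"
    by (intro emeasure_mono) auto
  then have "superlevel_length g c \<le> r"
    using \<open>0 < r\<close> unfolding emeasure_superlevel by simp
  then show False
    using assms(3) by simp
qed

text \<open>The bound holds because it holds pointwise: if \<open>m\<close> is the first index with
  \<open>g t < M / \<alpha> ^ m\<close>, then \<open>t\<close> lies in the first \<open>m\<close> superlevel sets, and
  \<open>ln (M / \<alpha> ^ m) = ln M + m * ln (1 / \<alpha>)\<close>.\<close>

lemma nn_integral_ln_plus_le:
  assumes anti: "antimono_on {0<..} g" and \<alpha>: "0 < \<alpha>" "\<alpha> < 1" and M: "1 \<le> M"
  shows "(\<integral>\<^sup>+t\<in>{0<..<1}. ennreal (ln_plus (g t)) \<partial>lborel)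
    \<le> ennreal (ln M) + ennreal (ln (1 / \<alpha>)) * (\<Sum>k. ennreal (superlevel_length g (M / \<alpha> ^ k)))"
proof -
  define A where "A k = {t\<in>{0<..<1}. M / \<alpha> ^ k \<le> g t}" for k
  define L where "L = ln (1 / \<alpha>)"
  have L: "0 \<le> L"
    using \<alpha> by (simp add: L_def)
  have [measurable]: "A k \<in> sets borel" for k
    using superlevel_sets_borel[OF anti] by (simp add: A_def)
  have ptwise: "ennreal (ln_plus (g t)) * indicator {0<..<1} t
      \<le> ennreal (ln M) * indicator {0<..<1} t + ennreal L * (\<Sum>k. indicator (A k) t)"
    for t :: real
  proof (cases "t \<in> {0<..<1}")
    case True
    define m where "m = (LEAST k. g t < M / \<alpha> ^ k)"
    obtain k where "g t / M < (1 / \<alpha>) ^ k"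
      using real_arch_pow[of "1 / \<alpha>" "g t / M"] \<alpha> by auto
    then have "g t < M / \<alpha> ^ k"
      using M by (simp add: field_simps)
    then have gm: "g t < M / \<alpha> ^ m"
      unfolding m_def by (rule LeastI)
    have "t \<in> A k" if "k < m" for k
      using not_less_Least[of k "\<lambda>k. g t < M / \<alpha> ^ k"] that True by (simp add: A_def m_def)
    then have "of_nat m = (\<Sum>k<m. indicator (A k) t :: ennreal)"
      by simp
    also have "\<dots> \<le> (\<Sum>k. indicator (A k) t)"
      by (intro sum_le_suminf) auto
    finally have m_le: "of_nat m \<le> (\<Sum>k. indicator (A k) t :: ennreal)" .
    have "\<alpha> ^ m \<le> 1"
      using \<alpha> by (simp add: power_le_one)
    then have "1 \<le> M / \<alpha> ^ m"
      using M \<alpha> by (simp add: field_simps)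
    then have "ln_plus (g t) \<le> ln (M / \<alpha> ^ m)"
      unfolding ln_plus_def using gm by simp
    also have "\<dots> = ln M + L * real m"
      using M \<alpha> by (simp add: L_def ln_div ln_realpow)
    finally have "ennreal (ln_plus (g t)) \<le> ennreal (ln M + L * real m)"
      by (rule ennreal_leI)
    also have "\<dots> = ennreal (ln M) + ennreal L * of_nat m"
      using M L by (simp add: ennreal_plus ennreal_mult ennreal_of_nat_eq_real_of_nat)
    also have "\<dots> \<le> ennreal (ln M) + ennreal L * (\<Sum>k. indicator (A k) t)"
      by (intro add_left_mono mult_left_mono m_le) auto
    finally show ?thesis
      using True by simp
  qed simp
  have "(\<integral>\<^sup>+t\<in>{0<..<1}. ennreal (ln_plus (g t)) \<partial>lborel)
      \<le> (\<integral>\<^sup>+t. ennreal (ln M) * indicator {0<..<1} t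
            + ennreal L * (\<Sum>k. indicator (A k) t) \<partial>lborel)"
    by (intro nn_integral_mono ptwise)
  also have "\<dots> = ennreal (ln M) + ennreal L * (\<Sum>k. emeasure lborel (A k))"
    by (simp add: nn_integral_add nn_integral_cmult nn_integral_suminf)
  also have "\<dots> = ennreal (ln M)
      + ennreal L * (\<Sum>k. ennreal (superlevel_length g (M / \<alpha> ^ k)))"
    unfolding A_def emeasure_superlevel ..
  finally show ?thesis
    by (simp add: L_def)
qed

lemma superlevel_lengths_unbounded:
  assumes anti: "antimono_on {0<..} g" and \<alpha>: "0 < \<alpha>" "\<alpha> < 1" and M: "1 \<le> M"
    and inf: "(\<integral>\<^sup>+t\<in>{0<..<1}. ennreal (ln_plus (g t)) \<partial>lborel) = \<infinity>"
  shows "\<exists>n. B < (\<Sum>k<n. superlevel_length g (M / \<alpha> ^ k))"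
proof (rule ccontr)
  assume "\<not> ?thesis"
  then have "(\<Sum>k<n. superlevel_length g (M / \<alpha> ^ k)) \<le> B" for n
    by (simp add: not_less)
  then have "(\<Sum>k<n. ennreal (superlevel_length g (M / \<alpha> ^ k))) \<le> ennreal B" for n
    by (simp add: superlevel_length_nonneg ennreal_leI)
  then have "(\<Sum>k. ennreal (superlevel_length g (M / \<alpha> ^ k))) \<le> ennreal B"
    by (intro suminf_le_const) auto
  then have "(\<Sum>k. ennreal (superlevel_length g (M / \<alpha> ^ k))) < \<infinity>"
    using ennreal_less_top[of B] by (simp add: order_le_less_trans)
  then have "ennreal (ln M) + ennreal (ln (1 / \<alpha>))
      * (\<Sum>k. ennreal (superlevel_length g (M / \<alpha> ^ k))) < \<infinity>"
    by (simp add: ennreal_mult_less_top)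
  then show False
    using nn_integral_ln_plus_le[OF anti \<alpha> M] unfolding inf by (simp add: top_unique)
qed

text \<open>The step lengths \<open>d k\<close> enter only through the two properties used here: \<open>g\<close> is at least
  the \<open>k\<close>-th level up to distance \<open>d k\<close>, and the steps together cover every distance to the
  left of \<open>x\<close>.\<close>

lemma step_function_in_family:
  fixes d :: "nat \<Rightarrow> real"
  assumes g: "\<And>r. 0 < r \<Longrightarrow> 0 \<le> g r" and \<alpha>: "0 < \<alpha>" "\<alpha> < 1" and M: "0 \<le> M"
    and d: "\<And>k. 0 \<le> d k"
    and level: "\<And>k r. 0 < r \<Longrightarrow> r < d k \<Longrightarrow> M / \<alpha> ^ k \<le> g r"
    and unbounded: "\<And>B. \<exists>n. B < (\<Sum>k<n. d k)"
  shows "\<exists>f\<in>family g \<alpha>. M \<le> f x"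
proof -
  define D where "D n = (\<Sum>k<n. d k)" for n
  \<comment> \<open>\<open>s\<close> lies on step \<open>N s\<close> if \<open>D (N s) \<le> x - s < D (Suc (N s))\<close>; steps of length \<open>0\<close> are skipped.\<close>
  define N where "N s = (LEAST n. x - s < D (Suc n))" for s
  define f where "f s = (if x < s then 0 else M / \<alpha> ^ N s)" for s
  have ex: "\<exists>n. x - s < D (Suc n)" for s
  proof -
    obtain n where "x - s < D n"
      using unbounded D_def by auto
    also have "D n \<le> D (Suc n)"
      using d by (simp add: D_def)
    finally show ?thesis ..
  qed
  have N_upper: "x - s < D (Suc (N s))" for s
    unfolding N_def using ex by (rule LeastI_ex)
  have N_lower: "D (N s) \<le> x - s" if "s \<le> x" for s
  proof (cases "N s")
    case 0
    then show ?thesis using that by (simp add: D_def)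
  next
    case (Suc n)
    then have "\<not> x - s < D (Suc n)"
      unfolding N_def by (intro not_less_Least) simp
    then show ?thesis using Suc by simp
  qed
  have N_anti: "N t \<le> N s" if "s \<le> t" for s t
  proof -
    have "x - t < D (Suc (N s))"
      using N_upper[of s] that by simp
    then show ?thesis
      unfolding N_def[of t] by (rule Least_le)
  qed
  have level_mono: "M / \<alpha> ^ m \<le> M / \<alpha> ^ n" if "m \<le> n" for m n
    using that \<alpha> M by (intro divide_left_mono power_decreasing mult_pos_pos zero_less_power) auto
  have f_nonneg: "0 \<le> f s" for s
    using \<alpha> M by (simp add: f_def)
  have f_anti: "f t \<le> f s" if "s \<le> t" for s t
  proof (cases "x < t")
    case True
    then show ?thesis using f_nonneg[of s] by (simp add: f_def)
  next
    case False
    then show ?thesis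
      using that level_mono[OF N_anti[OF that]] by (simp add: f_def)
  qed
  have "f (r + s) \<le> g r + \<alpha> * f s" if rs: "0 < r" "0 < s" for r s
  proof (cases "x < r + s")
    case True
    then show ?thesis
      using g[OF rs(1)] f_nonneg[of s] \<alpha> by (simp add: f_def)
  next
    case False
    then have le: "r + s \<le> x" "s \<le> x"
      using rs by auto
    consider "N s = N (r + s)" | "Suc (N (r + s)) \<le> N s"
      using N_anti[of s "r + s"] rs by linarith
    then show ?thesis
    proof cases
      case 1
      have "r < D (Suc (N s)) - D (N s)"
        using N_upper[of s] N_lower[OF le(1)] 1 by simp
      then have "r < d (N s)"
        by (simp add: D_def)
      then have "f (r + s) \<le> g r"
        using level[OF rs(1)] le 1 by (simp add: f_def)
      then show ?thesis
        using f_nonneg[of s] \<alpha> by (simp add: add_increasing2)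
    next
      case 2
      have "f (r + s) = \<alpha> * (M / \<alpha> ^ Suc (N (r + s)))"
        using le \<alpha> by (simp add: f_def)
      also have "\<dots> \<le> \<alpha> * f s"
        using level_mono[OF 2] le \<alpha> by (intro mult_left_mono) (auto simp: f_def)
      finally show ?thesis
        using g[OF rs(1)] by simp
    qed
  qed
  then have "f \<in> family g \<alpha>"
    using f_nonneg f_anti by (auto simp: family_def decreasing_nonneg_def monotone_on_def)
  moreover have "M \<le> f x"
    using level_mono[of 0 "N x"] by (simp add: f_def)
  ultimately show ?thesis
    by blast
qed

theorem theorem2p5:
  fixes g :: "real \<Rightarrow> real" and \<alpha> :: real
  assumes "decreasing_nonneg g"
    and "0 < \<alpha>" and "\<alpha> < 1"
    and "(\<integral>\<^sup>+t\<in>{0<..<1}. ennreal (ln_plus (g t)) \<partial>lborel) = \<infinity>"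
  shows "\<forall>x>0. (SUP f\<in>family g \<alpha>. ereal (f x)) = \<infinity>"
proof (intro allI impI)
  fix x :: real
  have anti: "antimono_on {0<..} g" and nonneg: "\<And>r. 0 < r \<Longrightarrow> 0 \<le> g r"
    using assms(1) by (auto simp: decreasing_nonneg_def)
  have "\<exists>f\<in>family g \<alpha>. M \<le> f x" if M: "1 \<le> M" for M
    using M
    by (intro step_function_in_family[where d = "\<lambda>k. superlevel_length g (M / \<alpha> ^ k)"]
        nonneg assms(2,3) superlevel_length_nonneg level_le_of_less_superlevel_length[OF anti]
        superlevel_lengths_unbounded[OF anti assms(2,3) M assms(4)]) auto
  then have large: "\<exists>f\<in>family g \<alpha>. max 1 (real n) \<le> f x" for n
    using max.cobounded1 by blast
  show "(SUP f\<in>family g \<alpha>. ereal (f x)) = \<infinity>"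
  proof (rule SUP_PInfty)
    fix n :: nat
    show "\<exists>f\<in>family g \<alpha>. ereal (real n) \<le> ereal (f x)"
      using large[of n] by auto
  qed
qed

end
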